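(* For every integer $n\ge 1$, $$|\mathcal{S}_n(32;\,1\to 1)| = d_n + d_{n-1} + \sum_{m=1}^{n-1}\sum_{r=0}^{m-1}\binom{m-1}{r}\binom{n-m+r-1}{r}\, r!\; d_{m-1-r},$$ where $d_j$ denotes the $j$-th derangement number.
   Context: $[n]=\{1,\dots,n\}$, and $\mathcal{S}_n$ is the set of permutations $\pi=\pi_1\pi_2\cdots\pi_n$ of $[n]$ in one-line notation. The permutation $\hat\pi$: for $\pi\in\mathcal{S}_n$, $\hat\pi\in\mathcal{S}_n$ is the permutation whose cycle form is obtained from the word $\pi_1\cdots\pi_n$ by inserting a left parenthesis before each left-to-right maximum (an entry larger than all entries to its left) and a right parenthesis immediately before the next left-to-right maximum, or at the end of the word. A cycle $(c_1,c_2,\dots,c_s)$ means $c_1\mapsto c_2\mapsto\cdots\mapsto c_s\mapsto c_1$. Example: if $\pi=2537164$ then $\hat\pi=(2)(53)(7164)$. Arrow patterns: an arrow pattern of size $k$ is a pair $(\nu;H)$ where $\nu=\nu_1\cdots\nu_m$ is a word of distinct positive integers, $H$ is a collection of arrows $b_i\to c_i$, and the set of all integers appearing in $\nu$ or $H$ is $[k]$. A permutation $\pi\in\mathcal{S}_n$ contains $(\nu;H)$ if there are a set $X=\{x_1<x_2<\cdots<x_k\}\subseteq[n]$ and indices $t_1<\cdots<t_m$ such that $\pi_{t_1}\pi_{t_2}\cdots\pi_{t_m}=x_{\nu_1}x_{\nu_2}\cdots x_{\nu_m}$ and $\hat\pi(x_{b_i})=x_{c_i}$ for every arrow $b_i\to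 c_i$ in $H$. Otherwise $\pi$ avoids $(\nu;H)$. $\mathcal{S}_n(\nu;H)$ is the set of permutations in $\mathcal{S}_n$ avoiding $(\nu;H)$. The derangement number $d_j$ is the number of permutations of $[j]$ without fixed points ($d_0=1$, $d_1=0$). *)

theory Defs
  imports "HOL-Combinatorics.Combinatorics" "HOL-Library.Sublist"
begin

text \<open>
  A permutation of \<open>{1..n}\<close> in one-line notation is a list in
  \<^term>\<open>permutations_of_set {1..n::nat}\<close>.

  The word is cut immediately before each of its left-to-right maxima: the first letter \<open>x\<close> of a
  block is a left-to-right maximum, and the next one is the first later letter exceeding \<open>x\<close>.
\<close>

function lr_max_blocks :: "nat list \<Rightarrow> nat list list" where
  "lr_max_blocks [] = []"
| "lr_max_blocks (x # w) =
     (x # takeWhile (\<lambda>y. y \<le> x) w) # lr_max_blocks (dropWhile (\<lambda>y. y \<le> x) w)"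
  by pat_completeness auto
termination
  by (relation "measure length") (auto simp: less_Suc_eq_le length_dropWhile_le)

text \<open>
  The map with cycle form given by the blocks.  \<^const>\<open>cycle_of_list\<close> sends each entry of the
  list to its successor and the last entry to the first.
\<close>

definition hat :: "nat list \<Rightarrow> nat \<Rightarrow> nat" where
  "hat w = foldr (\<circ>) (map cycle_of_list (lr_max_blocks w)) id"

lemma lr_max_blocks_example:
  "lr_max_blocks [2,5,3,7,1,6,4] = [[2], [5,3], [7,1,6,4]]"
  by simp

lemma hat_example: "map (hat [2,5,3,7,1,6,4]) [1..<8] = [6,2,5,7,3,4,1]"
  by (simp add: hat_def transpose_def upt_rec)

text \<open>A pair \<open>(\<nu>, H)\<close>, where \<open>(b, c) \<in> H\<close> stands for an arrow \<open>b \<rightarrow> c\<close>.\<close>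

type_synonym arrow_pattern = "nat list \<times> (nat \<times> nat) set"

definition pattern_letters :: "arrow_pattern \<Rightarrow> nat set" where
  "pattern_letters P = set (fst P) \<union> fst ` snd P \<union> snd ` snd P"

definition is_arrow_pattern :: "nat \<Rightarrow> arrow_pattern \<Rightarrow> bool" where
  "is_arrow_pattern k P \<longleftrightarrow> distinct (fst P) \<and> pattern_letters P = {1..k}"

definition pattern_size :: "arrow_pattern \<Rightarrow> nat" where
  "pattern_size P = card (pattern_letters P)"

text \<open>
  The set \<open>X = {x\<^sub>1 < \<dots> < x\<^sub>k}\<close> is given by its increasing enumeration \<open>x\<close>.
  \<^const>\<open>subseq\<close> (not necessarily contiguous) expresses the existence of the indices
  \<open>t\<^sub>1 < \<dots> < t\<^sub>m\<close>.
\<close>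

definition contains_arrow_pattern :: "nat list \<Rightarrow> arrow_pattern \<Rightarrow> bool" where
  "contains_arrow_pattern w P \<longleftrightarrow>
     (\<exists>x :: nat \<Rightarrow> nat.
        strict_mono_on {1..pattern_size P} x \<and>
        x ` {1..pattern_size P} \<subseteq> {1..length w} \<and>
        subseq (map x (fst P)) w \<and>
        (\<forall>(b, c) \<in> snd P. hat w (x b) = x c))"

definition avoiders :: "nat \<Rightarrow> arrow_pattern \<Rightarrow> nat list set" where
  "avoiders n P = {w \<in> permutations_of_set {1..n}. \<not> contains_arrow_pattern w P}"

lemma is_arrow_pattern_32_11: "is_arrow_pattern 3 ([3, 2], {(1, 1)})"
  by (auto simp: is_arrow_pattern_def pattern_letters_def)

lemma pattern_size_eq: "is_arrow_pattern k P \<Longrightarrow> pattern_size P = k"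
  by (simp add: is_arrow_pattern_def pattern_size_def)

definition derangement_number :: "nat \<Rightarrow> nat" where
  "derangement_number j = card {p. p permutes {1..j} \<and> (\<forall>i \<in> {1..j}. p i \<noteq> i)}"

end

theory Submission
  imports Defs
begin

text \<open>
  A word \<open>w\<close> avoids the pattern iff, for its least fixed point \<open>m\<close> of \<^term>\<open>hat w\<close> (if there is
  any), the letters above \<open>m\<close> occur in increasing order.  Words without fixed points correspond to
  derangements, because \<^const>\<open>hat\<close> is a bijection.  If \<open>m = n\<close>, then \<open>w = A @ [n]\<close> with \<open>A\<close> free of
  fixed points.  If \<open>m < n\<close>, then \<open>w = A @ m # (m + 1) # C\<close>, where \<open>A\<close> is free of fixed points and
  \<open>C\<close> shuffles an arbitrary word on the \<open>r\<close> letters below \<open>m\<close> missing from \<open>A\<close> with the increasing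
  word on \<open>{m + 2..n}\<close>; no letter below \<open>m\<close> that follows \<open>m\<close> starts a block, so none is fixed.
\<close>

section \<open>The map from words to permutations\<close>

text \<open>The head of \<open>B\<close> exceeds every letter of \<open>A\<close>, so it is a
  left-to-right maximum of the whole word and no block of \<open>A\<close> runs across the
  cut.\<close>

lemma lr_max_blocks_append:
  assumes "B = [] \<or> (\<forall>a\<in>set A. a < hd B)"
  shows "lr_max_blocks (A @ B) = lr_max_blocks A @ lr_max_blocks B"
  using assms
proof (induction A rule: lr_max_blocks.induct)
  case (2 x w)
  show ?case
  \<comment> \<open>If the first block exhausts \<open>A\<close>, it is stopped by the head of
    \<open>B\<close>. Otherwise it ends inside \<open>w\<close>, and the induction hypothesis treats
    what remains.\<close>
  proof (cases "\<forall>y\<in>set w. y \<le> x")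
    case True
    have "takeWhile (\<lambda>y. y \<le> x) B = []" "dropWhile (\<lambda>y. y \<le> x) B = B"
      using "2.prems" by (cases B; simp)+
    moreover have "takeWhile (\<lambda>y. y \<le> x) w = w" "dropWhile (\<lambda>y. y \<le> x) w = []"
      using True by simp_all
    ultimately show ?thesis
      using True by (simp add: takeWhile_append2 dropWhile_append2 del: takeWhile_eq_all_conv dropWhile_eq_Nil_conv)
  next
    case False
    then obtain y where y: "y \<in> set w" "\<not> y \<le> x" by blast
    have "set (dropWhile (\<lambda>y. y \<le> x) w) \<subseteq> set w"
      by (auto dest: set_dropWhileD)
    then have "lr_max_blocks (dropWhile (\<lambda>y. y \<le> x) w @ B) =
        lr_max_blocks (dropWhile (\<lambda>y. y \<le> x) w) @ lr_max_blocks B"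
      using "2.prems" by (intro "2.IH") auto
    then show ?thesis
      using takeWhile_append1[OF y(1), of "\<lambda>y. y \<le> x"] dropWhile_append1[OF y(1), of "\<lambda>y. y \<le> x"] y(2)
      by simp
  qed
qed simp

lemma hat_Nil [simp]: "hat [] = id"
  by (simp add: hat_def)

lemma hat_append:
  assumes "B = [] \<or> (\<forall>a\<in>set A. a < hd B)"
  shows "hat (A @ B) = hat A \<circ> hat B"
proof -
  have "foldr (\<circ>) fs g = foldr (\<circ>) fs id \<circ> g" for fs and g :: "nat \<Rightarrow> nat"
    by (induction fs) (simp_all add: comp_assoc)
  from this[of "map cycle_of_list (lr_max_blocks A)" "hat B"] show ?thesis
    by (simp add: hat_def lr_max_blocks_append[OF assms])
qed

lemma hat_Max_Cons:
  assumes "\<forall>b\<in>set B. b \<le> M"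
  shows "hat (M # B) = cycle_of_list (M # B)"
proof -
  have "takeWhile (\<lambda>y. y \<le> M) B = B" "dropWhile (\<lambda>y. y \<le> M) B = []"
    using assms by simp_all
  then show ?thesis
    unfolding hat_def by (simp del: cycle_of_list.simps takeWhile_eq_all_conv dropWhile_eq_Nil_conv)
qed

lemma ex_Max_split:
  fixes w :: "nat list"
  assumes "distinct w" "w \<noteq> []"
  obtains A M B where "w = A @ M # B" "\<forall>a\<in>set A. a < M" "\<forall>b\<in>set B. b < M"
proof -
  have "Max (set w) \<in> set w" using assms by simp
  then obtain A B where AB: "w = A @ Max (set w) # B" by (auto simp: in_set_conv_decomp)
  define M where "M = Max (set w)"
  have w: "w = A @ M # B" using AB M_def by simp
  have le: "x \<le> M" if "x \<in> set w" for x using that M_def by simp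
  have "\<forall>a\<in>set A. a < M" "\<forall>b\<in>set B. b < M"
    using le assms(1) unfolding w by (auto simp: less_le)
  then show ?thesis using that w by blast
qed

text \<open>The maximum opens the last block \<open>M # B\<close>, on which \<open>hat\<close> is a
  single cycle. Hence only the prefix \<open>A\<close> needs an induction hypothesis.\<close>

lemma Max_split_induct [consumes 1, case_names Nil split]:
  fixes w :: "nat list"
  assumes "distinct w"
    and "P []"
    and "\<And>A M B. \<lbrakk>distinct (A @ M # B); \<forall>a\<in>set A. a < M; \<forall>b\<in>set B. b < M; P A\<rbrakk> \<Longrightarrow> P (A @ M # B)"
  shows "P w"
  using assms(1)
proof (induction w rule: length_induct)
  case (1 w)
  show ?case
  proof (cases "w = []")
    case False
    obtain A M B where w: "w = A @ M # B" "\<forall>a\<in>set A. a < M" "\<forall>b\<in>set B. b < M"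
      using ex_Max_split[OF \<open>distinct w\<close> False] .
    with 1 show ?thesis by (auto intro: assms(3))
  qed (use assms(2) in simp)
qed

lemma hat_permutes:
  assumes "distinct w"
  shows "hat w permutes set w"
  using assms
proof (induction w rule: Max_split_induct)
  case Nil
  show ?case using permutes_id[of "{}"] by (simp add: id_def)
next
  case (split A M B)
  have "hat (A @ M # B) = hat A \<circ> cycle_of_list (M # B)"
    using split by (simp add: hat_append hat_Max_Cons less_imp_le del: cycle_of_list.simps)
  moreover have "hat A permutes set (A @ M # B)"
    by (rule permutes_subset[OF split.IH]) auto
  moreover have "cycle_of_list (M # B) permutes set (A @ M # B)"
    by (rule permutes_subset[OF cycle_permutes]) auto
  ultimately show ?case by (simp only: permutes_compose)
qed

text \<open>The factors \<open>hat A\<close> and \<open>hat B\<close> permute disjoint sets of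
  letters, so at most one of them moves a given letter.\<close>

lemma hat_append_apply:
  assumes "distinct (A @ B)" "B = [] \<or> (\<forall>a\<in>set A. a < hd B)"
  shows "x \<in> set A \<Longrightarrow> hat (A @ B) x = hat A x"
    and "x \<in> set B \<Longrightarrow> hat (A @ B) x = hat B x"
proof -
  have A: "hat A permutes set A" and B: "hat B permutes set B"
    using assms(1) by (simp_all add: hat_permutes)
  show "hat (A @ B) x = hat A x" if "x \<in> set A"
  proof -
    have "x \<notin> set B" using that assms(1) by auto
    then show ?thesis
      using permutes_not_in[OF B, of x] by (simp add: hat_append[OF assms(2)])
  qed
  show "hat (A @ B) x = hat B x" if "x \<in> set B"
  proof -
    have "hat B x \<in> set B" using that permutes_in_image[OF B] by simp
    then show ?thesis
      using assms permutes_not_in[OF A, of "hat B x"] by (auto simp: hat_append)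
  qed
qed

section \<open>Recovering a word from its cycles\<close>

text \<open>Applying the cycle \<open>i\<close> times to all entries rotates the list by
  \<open>i\<close>; the claim compares the heads.\<close>

lemma cycle_of_list_iterate:
  assumes "distinct (x # u)"
  shows "(cycle_of_list (x # u) ^^ i) x = (x # u) ! (i mod length (x # u))"
proof -
  have "(cycle_of_list (x # u) ^^ i) x = hd (map (cycle_of_list (x # u) ^^ i) (x # u))"
    by (simp del: cycle_of_list.simps)
  also have "\<dots> = hd (rotate i (x # u))"
    using cyclic_rotation[OF assms] by metis
  finally show ?thesis by (simp add: hd_rotate_conv_nth del: cycle_of_list.simps)
qed

lemma cycle_of_list_eq_fixed:
  assumes "distinct (x # u)" "cycle_of_list (x # u) x = x"
  shows "u = []"
proof (rule ccontr)
  assume "u \<noteq> []"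
  then obtain y v where "u = y # v" by (cases u) auto
  with assms show False
    using cycle_of_list_iterate[OF assms(1), of 1] by (simp del: cycle_of_list.simps)
qed

text \<open>Both lists spell out the orbit of \<open>x\<close> under \<open>f\<close>, and their
  common length is the first return time to \<open>x\<close>. Each cycle is compared with
  \<open>f\<close> only on its own letters, since the two lists are not known beforehand to have the
  same letters.\<close>

lemma cycle_lists_eq:
  assumes "distinct (x # u)" "distinct (x # v)"
    and "\<And>y. y \<in> set (x # u) \<Longrightarrow> cycle_of_list (x # u) y = f y"
    and "\<And>y. y \<in> set (x # v) \<Longrightarrow> cycle_of_list (x # v) y = f y"
  shows "u = v"
proof -
  have iter: "(f ^^ i) x = (x # u) ! (i mod length (x # u))"
    if "distinct (x # u)" "\<And>y. y \<in> set (x # u) \<Longrightarrow> cycle_of_list (x # u) y = f y" for u i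
  proof -
    have "(f ^^ i) x = (cycle_of_list (x # u) ^^ i) x"
    proof (induction i)
      case (Suc i)
      have "(cycle_of_list (x # u) ^^ i) x \<in> set (x # u)"
        unfolding cycle_of_list_iterate[OF that(1)] by (rule nth_mem) simp
      then show ?case using Suc that(2) by (simp del: cycle_of_list.simps)
    qed simp
    then show ?thesis using cycle_of_list_iterate[OF that(1)] by simp
  qed
  have not_shorter: "\<not> length u < length v"
    if u: "distinct (x # u)" "\<And>y. y \<in> set (x # u) \<Longrightarrow> cycle_of_list (x # u) y = f y"
      and v: "distinct (x # v)" "\<And>y. y \<in> set (x # v) \<Longrightarrow> cycle_of_list (x # v) y = f y" for u v
  proof
    \<comment> \<open>After \<open>length (x # u)\<close> steps the shorter cycle is back at
      \<open>x\<close>, so the longer list would contain \<open>x\<close> at a second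
      position.\<close>
    assume "length u < length v"
    then have "(x # v) ! length (x # u) = x"
      using iter[OF u, of "length (x # u)"] iter[OF v, of "length (x # u)"] by simp
    then show False using v(1) \<open>length u < length v\<close> by auto
  qed
  have len: "length u = length v"
    using not_shorter[OF assms(1,3,2,4)] not_shorter[OF assms(2,4,1,3)] by linarith
  have "x # u = x # v"
  proof (rule nth_equalityI)
    fix i assume "i < length (x # u)"
    then show "(x # u) ! i = (x # v) ! i"
      using iter[OF assms(1,3), of i] iter[OF assms(2,4), of i] len by simp
  qed (simp add: len)
  then show ?thesis by simp
qed

text \<open>
  The orbit of the maximum under \<^term>\<open>hat w\<close>, listed from the maximum on, is the last block of
  \<open>w\<close>; the earlier blocks are recovered recursively.
\<close>

lemma hat_inject:
  assumes "distinct w" "distinct w'" "set w = set w'" "hat w = hat w'"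
  shows "w = w'"
  using assms
proof (induction w arbitrary: w' rule: Max_split_induct)
  case (split A M B)
  note less = split(2,3)
  have "w' \<noteq> []" using split.prems by auto
  then obtain A' M' B' where w': "w' = A' @ M' # B'"
    and less': "\<forall>a\<in>set A'. a < M'" "\<forall>b\<in>set B'. b < M'"
    using ex_Max_split split.prems(1) by blast
  have M: "M' = M"
  proof (rule antisym)
    have "M' \<in> set (A @ M # B)" "M \<in> set (A' @ M' # B')"
      using split.prems(2) w' by auto
    then show "M' \<le> M" "M \<le> M'" using less less' by auto
  qed
  have d: "distinct (A @ M # B)" "distinct (A' @ M # B')"
    using split(1) split.prems(1) w' M by auto
  have hats: "hat (A @ M # B) = hat (A' @ M # B')" using split.prems w' M by simp
  have cyc: "hat (M # B) = cycle_of_list (M # B)" "hat (M # B') = cycle_of_list (M # B')"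
    using less less' M by (simp_all add: hat_Max_Cons less_imp_le del: cycle_of_list.simps)
  note app = hat_append_apply[OF d(1)] hat_append_apply[OF d(2)]
  \<comment> \<open>The common function is \<open>hat (A @ M # B)\<close>, which agrees with each
    last block on the letters of that block because the two words have the same
    \<open>hat\<close>.\<close>
  have "B = B'"
  proof (rule cycle_lists_eq)
    show "distinct (M # B)" "distinct (M # B')" using d by auto
    show "cycle_of_list (M # B) y = hat (A @ M # B) y" if "y \<in> set (M # B)" for y
      using app(2)[OF _ that] less cyc(1) by simp
    show "cycle_of_list (M # B') y = hat (A @ M # B) y" if "y \<in> set (M # B')" for y
      using app(4)[OF _ that] less' M cyc(2) hats by simp
  qed
  \<comment> \<open>The letters of the prefix are those outside the last block, which is now known
    to be the same in both words.\<close>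
  have sets: "set A = set A'"
  proof -
    have "set A = set (A @ M # B) - set (M # B)" "set A' = set (A' @ M # B') - set (M # B')"
      using d by auto
    then show ?thesis using split.prems(2) w' M \<open>B = B'\<close> by (simp only:)
  qed
  have "hat A = hat A'"
  proof
    fix x
    show "hat A x = hat A' x"
    proof (cases "x \<in> set A")
      case True
      then show ?thesis using app(1)[of x] app(3)[of x] less less' M hats sets by simp
    next
      case False
      have "distinct A" "distinct A'" using d by auto
      then show ?thesis
        using False sets permutes_not_in[OF hat_permutes] by metis
    qed
  qed
  then have "A = A'" using split.IH[of A'] d sets by simp
  then show ?case using w' M \<open>B = B'\<close> by simp
qed simp

text \<open>Injectivity is \<open>hat_inject\<close>. Surjectivity follows by counting, as both sets
  have \<open>fact (card S)\<close> elements; no inverse is constructed.\<close>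

lemma hat_bij_betw:
  assumes "finite S"
  shows "bij_betw hat (permutations_of_set S) {p. p permutes S}"
proof -
  have inj: "inj_on hat (permutations_of_set S)"
    by (rule inj_onI) (metis hat_inject permutations_of_setD)
  have "hat ` permutations_of_set S = {p. p permutes S}"
  proof (rule card_subset_eq)
    show "finite {p. p permutes S}" using assms by (rule finite_permutations)
    show "hat ` permutations_of_set S \<subseteq> {p. p permutes S}"
      using hat_permutes permutations_of_setD by blast
    show "card (hat ` permutations_of_set S) = card {p. p permutes S}"
      using assms by (simp add: card_image[OF inj] card_permutations)
  qed
  with inj show ?thesis by (simp add: bij_betw_def)
qed

text \<open>Conjugation by a bijection from \<open>S\<close> to \<open>{1..card S}\<close> carries
  fixed points to fixed points. This frees \<open>derangement_number\<close> from the particular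
  ground set in its definition.\<close>

lemma card_derangements:
  assumes "finite S"
  shows "card {p. p permutes S \<and> (\<forall>i\<in>S. p i \<noteq> i)} = derangement_number (card S)"
proof -
  obtain f where f: "bij_betw f S {1..card S}"
    using finite_same_card_bij[OF assms, of "{1..card S}"] by auto
  define g where "g = inv_into S f"
  \<comment> \<open>\<open>F p\<close> is the conjugate of \<open>p\<close> by \<open>f\<close>,
    extended by the identity outside \<open>{1..card S}\<close>.\<close>
  define F where "F = (\<lambda>p x. if x \<in> {1..card S} then f (p (g x)) else x)"
  have F: "bij_betw F {p. p permutes S} {p. p permutes {1..card S}}"
    unfolding F_def g_def by (rule bij_betw_permutations[OF f])
  have fg: "f (g x) = x" "g x \<in> S" if "x \<in> {1..card S}" for x
    using f that by (auto simp: g_def bij_betw_def f_inv_into_f inv_into_into)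
  have gf: "g (f x) = x" "f x \<in> {1..card S}" if "x \<in> S" for x
    using f that by (auto simp: g_def bij_betw_def)
  have der: "(\<forall>i\<in>{1..card S}. F p i \<noteq> i) \<longleftrightarrow> (\<forall>i\<in>S. p i \<noteq> i)" if p: "p permutes S" for p
  proof -
    have "F p (f i) = f i \<longleftrightarrow> p i = i" if "i \<in> S" for i
    proof -
      have "p i \<in> S" using p that by (simp add: permutes_in_image)
      then show ?thesis
        using gf that unfolding F_def by (metis (mono_tags))
    qed
    moreover have "{1..card S} = f ` S" using f by (simp add: bij_betw_def)
    ultimately show ?thesis by auto
  qed
  have "bij_betw F {p \<in> {p. p permutes S}. \<forall>i\<in>S. p i \<noteq> i}
     {q \<in> {q. q permutes {1..card S}}. \<forall>i\<in>{1..card S}. q i \<noteq> i}"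
    unfolding bij_betw_def
  proof
    show "inj_on F {p \<in> {p. p permutes S}. \<forall>i\<in>S. p i \<noteq> i}"
      using F by (auto simp: bij_betw_def intro: inj_on_subset)
    have "F ` {p \<in> {p. p permutes S}. \<forall>i\<in>S. p i \<noteq> i} =
        {q \<in> F ` {p. p permutes S}. \<forall>i\<in>{1..card S}. q i \<noteq> i}"
      using der by blast
    then show "F ` {p \<in> {p. p permutes S}. \<forall>i\<in>S. p i \<noteq> i} =
        {q \<in> {q. q permutes {1..card S}}. \<forall>i\<in>{1..card S}. q i \<noteq> i}"
      using F by (simp add: bij_betw_def)
  qed
  from bij_betw_same_card[OF this] show ?thesis
    by (simp add: derangement_number_def)
qed

section \<open>Fixed points\<close>

definition fixpoint_free_words :: "nat set \<Rightarrow> nat list set" where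
  "fixpoint_free_words S = {w \<in> permutations_of_set S. \<forall>x\<in>S. hat w x \<noteq> x}"

lemma finite_fixpoint_free_words [simp]: "finite (fixpoint_free_words S)"
  by (simp add: fixpoint_free_words_def)

lemma card_fixpoint_free_words:
  assumes "finite S"
  shows "card (fixpoint_free_words S) = derangement_number (card S)"
proof -
  have inj: "inj_on hat (permutations_of_set S)"
    and im: "hat ` permutations_of_set S = {p. p permutes S}"
    using hat_bij_betw[OF assms] by (simp_all add: bij_betw_def)
  have "inj_on hat (fixpoint_free_words S)"
    using inj by (auto simp: fixpoint_free_words_def intro: inj_on_subset)
  moreover have "hat ` fixpoint_free_words S = {p \<in> hat ` permutations_of_set S. \<forall>i\<in>S. p i \<noteq> i}"
    by (auto simp: fixpoint_free_words_def)
  ultimately show ?thesis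
    using card_image card_derangements[OF assms] unfolding im by fastforce
qed

text \<open>A fixed point forms a block of its own: it is a left-to-right maximum, and the next
  letter, if any, starts a new block. In the induction it lies either in the prefix or in the last
  cycle, which then has length one.\<close>

lemma hat_fixpointD:
  assumes "distinct w" "z \<in> set w" "hat w z = z"
  obtains A B where "w = A @ z # B" "\<forall>a\<in>set A. a < z" "B = [] \<or> z < hd B"
proof -
  have "\<exists>A B. w = A @ z # B \<and> (\<forall>a\<in>set A. a < z) \<and> (B = [] \<or> z < hd B)"
    using assms
  proof (induction w rule: Max_split_induct)
    case (split A M B)
    note app = hat_append_apply[OF split(1), of z]
    show ?case
    proof (cases "z \<in> set A")
      case True
      then have "hat A z = z" using app(1) split by simp
      then obtain A1 A2 where A: "A = A1 @ z # A2" "\<forall>a\<in>set A1. a < z" "A2 = [] \<or> z < hd A2"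
        using split.IH True by blast
      have "A @ M # B = A1 @ z # (A2 @ M # B)" "z < hd (A2 @ M # B)"
        using A split(2) by (auto simp: hd_append)
      then show ?thesis using A(2) by blast
    next
      case False
      then have z: "z \<in> set (M # B)" using split.prems by auto
      then have fixz: "cycle_of_list (M # B) z = z"
        using app(2) split(2,3) split.prems by (simp add: hat_Max_Cons less_imp_le)
      have "B = []"
      proof (rule ccontr)
        assume "B \<noteq> []"
        have d: "distinct (M # B)" using split(1) by simp
        \<comment> \<open>Rotating the block to start at \<open>z\<close> leaves its cycle
          unchanged, and a cycle that fixes the head of its list has length one.\<close>
        obtain C D where CD: "M # B = C @ z # D" using z by (metis split_list)
        then have r: "rotate (length C) (M # B) = z # D @ C"
          by (simp add: rotate_append)
        have "cycle_of_list (z # D @ C) z = z"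
          using cycle_of_list_rotate_independent[OF d, of "length C"] fixz r by metis
        moreover have "distinct (z # D @ C)" using r d by (metis distinct_rotate)
        ultimately have "D @ C = []" by (rule cycle_of_list_eq_fixed[rotated])
        then show False using CD \<open>B \<noteq> []\<close> by simp
      qed
      then show ?thesis using z split(2) by auto
    qed
  qed simp
  then show ?thesis using that by blast
qed

text \<open>The word is cut both before and after \<open>m\<close>, so \<open>[m]\<close> is a block
  and \<open>hat\<close> acts separately on the three pieces.\<close>

lemma hat_fixpoint_split:
  assumes "distinct (A @ m # B)" "\<forall>a\<in>set A. a < m" "B = [] \<or> m < hd B"
  shows "hat (A @ m # B) m = m"
    and "x \<in> set A \<Longrightarrow> hat (A @ m # B) x = hat A x"
    and "x \<in> set B \<Longrightarrow> hat (A @ m # B) x = hat B x"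
proof -
  note app = hat_append_apply[OF assms(1)]
  have "distinct ([m] @ B)" using assms(1) by simp
  note app' = hat_append_apply[OF this]
  have "hat [m] m = m" by (simp add: hat_def)
  then show "hat (A @ m # B) m = m" using app(2)[of m] app'(1)[of m] assms by simp
  show "hat (A @ m # B) x = hat A x" if "x \<in> set A" using app(1)[of x] that assms by simp
  show "hat (A @ m # B) x = hat B x" if "x \<in> set B"
    using app(2)[of x] app'(2)[of x] that assms by simp
qed

section \<open>Avoiders by least fixed point\<close>

lemma subseq_imp_subset: "subseq xs ys \<Longrightarrow> set xs \<subseteq> set ys"
  by (induction rule: list_emb.induct) auto

lemma subseq_pair_Cons_iff:
  "subseq [c, b] (x # w) \<longleftrightarrow> subseq [c, b] w \<or> c = x \<and> b \<in> set w"
proof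
  assume "subseq [c, b] w \<or> c = x \<and> b \<in> set w"
  then show "subseq [c, b] (x # w)"
    using subseq_imp_subset[of "[c, b]" w] by (auto simp: subseq_singleton_left)
next
  assume "subseq [c, b] (x # w)"
  then show "subseq [c, b] w \<or> c = x \<and> b \<in> set w"
    by (cases "c = x") (simp_all add: subseq_singleton_left)
qed

lemma sorted_iff_no_inversion:
  fixes w :: "nat list"
  shows "sorted w \<longleftrightarrow> (\<forall>c b. subseq [c, b] w \<longrightarrow> c \<le> b)"
  by (induction w) (auto simp: subseq_pair_Cons_iff simp del: subseq_Cons2_iff)

lemma subseq_pair_filter_iff:
  "subseq [c, b] (filter Q w) \<longleftrightarrow> Q c \<and> Q b \<and> subseq [c, b] w"
  by (induction w) (auto simp: subseq_pair_Cons_iff simp del: subseq_Cons2_iff)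

text \<open>In an occurrence the smallest value is the fixed point \<open>a\<close>, and the other
  two form an inversion among the letters above \<open>a\<close>. Such an inversion exists exactly
  when those letters are not in increasing order.\<close>

lemma contains_32_11_iff:
  assumes "w \<in> permutations_of_set {1..n}"
  shows "contains_arrow_pattern w ([3, 2], {(1, 1)}) \<longleftrightarrow>
    (\<exists>a\<in>{1..n}. hat w a = a \<and> \<not> sorted (filter (\<lambda>y. a < y) w))"
proof -
  have set_w: "set w = {1..n}" and len: "length w = n"
    using assms distinct_card[of w] by (auto simp: permutations_of_set_def)
  have size: "pattern_size ([3, 2], {(1, 1)}) = 3"
    using pattern_size_eq[OF is_arrow_pattern_32_11] .
  have I: "{1..3} = {1, 2, 3::nat}" by auto
  show ?thesis
  proof
    assume "contains_arrow_pattern w ([3, 2], {(1, 1)})"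
    then obtain x :: "nat \<Rightarrow> nat" where x: "strict_mono_on {1..3} x" "x ` {1..3} \<subseteq> {1..n}"
        "subseq [x 3, x 2] w" "hat w (x 1) = x 1"
      unfolding contains_arrow_pattern_def size len by auto
    have "x 1 < x 2" "x 2 < x 3"
      using x(1) by (auto simp: strict_mono_on_def)
    then have "\<not> sorted (filter (\<lambda>y. x 1 < y) w)"
      using x(3) unfolding sorted_iff_no_inversion subseq_pair_filter_iff
      by (metis less_trans not_le)
    moreover have "x 1 \<in> {1..n}" using x(2) by (simp add: image_subset_iff)
    ultimately show "\<exists>a\<in>{1..n}. hat w a = a \<and> \<not> sorted (filter (\<lambda>y. a < y) w)"
      using x(4) by blast
  next
    assume "\<exists>a\<in>{1..n}. hat w a = a \<and> \<not> sorted (filter (\<lambda>y. a < y) w)"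
    then obtain a b c where abc: "a \<in> {1..n}" "hat w a = a" "subseq [c, b] w" "a < b" "b < c"
      unfolding sorted_iff_no_inversion subseq_pair_filter_iff by (auto simp: not_le)
    \<comment> \<open>The default value \<open>c\<close> is the one taken at index 3.\<close>
    define x where "x = (\<lambda>i::nat. if i = 1 then a else if i = 2 then b else c)"
    have "set [c, b] \<subseteq> set w" using abc(3) by (rule subseq_imp_subset)
    then have "x ` {1..3} \<subseteq> {1..n}"
      using abc(1) set_w unfolding I by (simp add: x_def)
    moreover have "strict_mono_on {1..3} x"
      unfolding strict_mono_on_def I using abc by (auto simp: x_def)
    moreover have "subseq (map x (fst ([3, 2], {(1::nat, 1::nat)}))) w"
      using abc(3) by (simp add: x_def)
    moreover have "hat w (x 1) = x 1" using abc(2) by (simp add: x_def)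
    ultimately show "contains_arrow_pattern w ([3, 2], {(1, 1)})"
      unfolding contains_arrow_pattern_def size len by auto
  qed
qed

text \<open>Order is tested only above the least fixed point \<open>m\<close>: the letters above a
  larger fixed point form a subword of those above \<open>m\<close>, so they are increasing
  too.\<close>

definition least_fixpoint_avoiders :: "nat \<Rightarrow> nat \<Rightarrow> nat list set" where
  "least_fixpoint_avoiders n m = {w \<in> permutations_of_set {1..n}.
     hat w m = m \<and> (\<forall>a\<in>{1..<m}. hat w a \<noteq> a) \<and> sorted (filter (\<lambda>y. m < y) w)}"

lemma finite_least_fixpoint_avoiders [simp]: "finite (least_fixpoint_avoiders n m)"
  by (simp add: least_fixpoint_avoiders_def)

lemma avoiders_eq_Un:
  "avoiders n ([3, 2], {(1, 1)}) =
    fixpoint_free_words {1..n} \<union> (\<Union>m\<in>{1..n}. least_fixpoint_avoiders n m)"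
proof (intro equalityI subsetI)
  fix w assume "w \<in> avoiders n ([3, 2], {(1, 1)})"
  then have w: "w \<in> permutations_of_set {1..n}"
    and srt: "\<And>a. a \<in> {1..n} \<Longrightarrow> hat w a = a \<Longrightarrow> sorted (filter (\<lambda>y. a < y) w)"
    by (auto simp: avoiders_def contains_32_11_iff simp del: One_nat_def)
  show "w \<in> fixpoint_free_words {1..n} \<union> (\<Union>m\<in>{1..n}. least_fixpoint_avoiders n m)"
  proof (cases "\<exists>a. a \<in> {1..n} \<and> hat w a = a")
    case True
    define m where "m = (LEAST a. a \<in> {1..n} \<and> hat w a = a)"
    have m: "m \<in> {1..n} \<and> hat w m = m" unfolding m_def using True by (rule LeastI_ex)
    have "hat w a \<noteq> a" if "a \<in> {1..<m}" for a
    proof -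
      have "a < m" "a \<in> {1..n}" using that m by auto
      then show ?thesis using not_less_Least[of a "\<lambda>a. a \<in> {1..n} \<and> hat w a = a"] m_def by blast
    qed
    then have "w \<in> least_fixpoint_avoiders n m"
      using w m srt by (simp add: least_fixpoint_avoiders_def)
    then show ?thesis using m by blast
  qed (use w in \<open>auto simp: fixpoint_free_words_def\<close>)
next
  fix w assume "w \<in> fixpoint_free_words {1..n} \<union> (\<Union>m\<in>{1..n}. least_fixpoint_avoiders n m)"
  then show "w \<in> avoiders n ([3, 2], {(1, 1)})"
  proof
    assume "w \<in> fixpoint_free_words {1..n}"
    then show ?thesis
      by (auto simp: fixpoint_free_words_def avoiders_def contains_32_11_iff simp del: One_nat_def)
  next
    assume "w \<in> (\<Union>m\<in>{1..n}. least_fixpoint_avoiders n m)"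
    then obtain m where w: "w \<in> permutations_of_set {1..n}"
      and m: "\<forall>a\<in>{1..<m}. hat w a \<noteq> a" "sorted (filter (\<lambda>y. m < y) w)"
      by (auto simp: least_fixpoint_avoiders_def)
    have "sorted (filter (\<lambda>y. a < y) w)" if "a \<in> {1..n}" "hat w a = a" for a
    proof -
      have "m \<le> a" using m(1) that by (meson atLeastAtMost_iff atLeastLessThan_iff not_le)
      with m(2) show ?thesis
        unfolding sorted_iff_no_inversion subseq_pair_filter_iff by (meson le_less_trans)
    qed
    then show ?thesis using w by (auto simp: avoiders_def contains_32_11_iff simp del: One_nat_def)
  qed
qed

text \<open>A letter following the fixed point \<open>n\<close> would have to start a block and
  exceed \<open>n\<close>, so \<open>n\<close> ends the word. No letter lies above \<open>n\<close>,
  hence the prefix is any word without fixed points.\<close>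

lemma card_greatest_fixpoint_avoiders:
  assumes "n \<ge> 1"
  shows "card (least_fixpoint_avoiders n n) = derangement_number (n - 1)"
proof -
  have "least_fixpoint_avoiders n n = (\<lambda>A. A @ [n]) ` fixpoint_free_words {1..<n}"
  proof (intro equalityI subsetI)
    fix w assume "w \<in> least_fixpoint_avoiders n n"
    then have w: "distinct w" "set w = {1..n}" "hat w n = n" "\<forall>a\<in>{1..<n}. hat w a \<noteq> a"
      by (auto simp: least_fixpoint_avoiders_def permutations_of_set_def)
    have "n \<in> set w" using w(2) assms by simp
    then obtain A B where AB: "w = A @ n # B" "\<forall>a\<in>set A. a < n" "B = [] \<or> n < hd B"
      using hat_fixpointD[OF w(1) _ w(3)] by blast
    have "B = []"
    proof (rule ccontr)
      assume "B \<noteq> []"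
      then have "hd B \<in> set w" "n < hd B" using AB by auto
      then show False using w(2) by simp
    qed
    have "set A = set w - {n}" using w(1) AB(1) \<open>B = []\<close> by auto
    also have "\<dots> = {1..<n}" unfolding w(2) by auto
    finally have setA: "set A = {1..<n}" .
    moreover have "hat A a \<noteq> a" if "a \<in> set A" for a
      using hat_fixpoint_split(2)[of A n B a] that AB w setA by auto
    ultimately have "A \<in> fixpoint_free_words {1..<n}"
      using w(1) AB(1) by (auto simp: fixpoint_free_words_def)
    then show "w \<in> (\<lambda>A. A @ [n]) ` fixpoint_free_words {1..<n}"
      using AB(1) \<open>B = []\<close> by blast
  next
    fix w assume "w \<in> (\<lambda>A. A @ [n]) ` fixpoint_free_words {1..<n}"
    then obtain A where A: "w = A @ [n]" "distinct A" "set A = {1..<n}" "\<forall>a\<in>{1..<n}. hat A a \<noteq> a"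
      by (auto simp: fixpoint_free_words_def permutations_of_set_def)
    have "distinct (A @ [n])" "\<forall>a\<in>set A. a < n" using A by auto
    note split = hat_fixpoint_split[OF this]
    have "set w = {1..n}" using A assms by auto
    moreover have "filter (\<lambda>y. n < y) w = []" using A by (auto simp: filter_empty_conv)
    ultimately show "w \<in> least_fixpoint_avoiders n n"
      using A split by (auto simp: least_fixpoint_avoiders_def)
  qed
  moreover have "inj_on (\<lambda>A. A @ [n]) (fixpoint_free_words {1..<n})"
    by (auto intro: inj_onI)
  ultimately show ?thesis by (simp add: card_image card_fixpoint_free_words)
qed

section \<open>Shuffles and the count for a given least fixed point\<close>

definition shuffled_words :: "nat set \<Rightarrow> nat list \<Rightarrow> nat list set" where
  "shuffled_words R v = (\<Union>u\<in>permutations_of_set R. shuffles u v)"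

text \<open>The word on \<open>R\<close> is recovered by filtering and may be arbitrary, so only the
  filter to the letters outside \<open>R\<close> imposes an order.\<close>

lemma shuffled_words_iff:
  assumes "R \<inter> set v = {}" "distinct v"
  shows "w \<in> shuffled_words R v \<longleftrightarrow>
    distinct w \<and> set w = R \<union> set v \<and> filter (\<lambda>x. x \<notin> R) w = v"
proof
  assume "w \<in> shuffled_words R v"
  then obtain u where u: "distinct u" "set u = R" "w \<in> shuffles u v"
    by (auto simp: shuffled_words_def permutations_of_set_def)
  then show "distinct w \<and> set w = R \<union> set v \<and> filter (\<lambda>x. x \<notin> R) w = v"
    using assms filter_shuffles_disjoint1(2)[of u v w] distinct_disjoint_shuffles[of u v w]
      set_shuffles[of w u v] by auto
next
  assume w: "distinct w \<and> set w = R \<union> set v \<and> filter (\<lambda>x. x \<notin> R) w = v"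
  then have "w \<in> shuffles (filter (\<lambda>x. x \<in> R) w) v"
    using partition_in_shuffles[of w "\<lambda>x. x \<in> R"] by simp
  moreover have "filter (\<lambda>x. x \<in> R) w \<in> permutations_of_set R"
    using w by (intro permutations_of_setI) auto
  ultimately show "w \<in> shuffled_words R v" by (auto simp: shuffled_words_def)
qed

text \<open>Filtering a shuffle to \<open>R\<close> returns \<open>u\<close>, so different orders of
  \<open>R\<close> give disjoint sets of shuffles, all of the same binomial size.\<close>

lemma card_shuffled_words:
  assumes "finite R" "R \<inter> set v = {}"
  shows "card (shuffled_words R v) = ((card R + length v) choose card R) * fact (card R)"
proof -
  have disj: "shuffles u v \<inter> shuffles u' v = {}"
    if "u \<in> permutations_of_set R" "u' \<in> permutations_of_set R" "u \<noteq> u'" for u u'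
  proof -
    have "filter (\<lambda>x. x \<in> R) w = u" if "w \<in> shuffles u v" "u \<in> permutations_of_set R" for w u
      using filter_shuffles_disjoint1(1)[of u v w] that assms(2)
      by (auto simp: permutations_of_set_def)
    with that show ?thesis by blast
  qed
  have "card (shuffled_words R v) = (\<Sum>u\<in>permutations_of_set R. card (shuffles u v))"
    unfolding shuffled_words_def using disj by (intro card_UN_disjoint) auto
  also have "\<dots> = (\<Sum>u\<in>permutations_of_set R. (card R + length v) choose card R)"
  proof (rule sum.cong[OF refl])
    fix u assume "u \<in> permutations_of_set R"
    then have "set u = R" "length u = card R"
      using distinct_card[of u] by (auto simp: permutations_of_set_def)
    then show "card (shuffles u v) = (card R + length v) choose card R"
      using card_disjoint_shuffles[of u v] assms(2) by simp
  qed
  finally show ?thesis using assms(1) by simp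
qed

lemma sum_Pow_card:
  fixes f :: "nat \<Rightarrow> nat"
  assumes "finite A"
  shows "(\<Sum>R\<in>Pow A. f (card R)) = (\<Sum>r = 0..card A. (card A choose r) * f r)"
proof -
  have "(\<Sum>r = 0..card A. \<Sum>R\<in>{R \<in> Pow A. card R = r}. f (card R)) = (\<Sum>R\<in>Pow A. f (card R))"
    using assms by (intro sum.group) (auto simp: card_mono)
  moreover have "(\<Sum>R\<in>{R \<in> Pow A. card R = r}. f (card R)) = (card A choose r) * f r" for r
  proof -
    have "(\<Sum>R\<in>{R \<in> Pow A. card R = r}. f (card R)) = (\<Sum>R\<in>{R \<in> Pow A. card R = r}. f r)"
      by (rule sum.cong) auto
    then show ?thesis using n_subsets[OF assms, of r] by simp
  qed
  ultimately show ?thesis by (simp only:)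
qed

text \<open>\<open>R\<close> collects the letters below \<open>m\<close> that stand after
  \<open>m\<close>. The letter right after \<open>m\<close> exceeds \<open>m\<close> and comes first
  among the increasing letters above \<open>m\<close>, so it is \<open>Suc m\<close>.\<close>

lemma least_fixpoint_avoiders_eq:
  assumes "1 \<le> m" "m < n"
  shows "least_fixpoint_avoiders n m =
    (\<lambda>(R, A, C). A @ m # Suc m # C) `
      (SIGMA R:Pow {1..<m}. fixpoint_free_words ({1..<m} - R) \<times> shuffled_words R [m + 2..<Suc n])"
    (is "_ = ?f ` ?S")
proof (intro equalityI subsetI)
  fix w assume "w \<in> least_fixpoint_avoiders n m"
  then have w: "distinct w" "set w = {1..n}" "hat w m = m" "\<forall>a\<in>{1..<m}. hat w a \<noteq> a"
      "sorted (filter (\<lambda>y. m < y) w)"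
    by (auto simp: least_fixpoint_avoiders_def permutations_of_set_def)
  have "m \<in> set w" using w(2) assms by simp
  then obtain A B where AB: "w = A @ m # B" "\<forall>a\<in>set A. a < m" "B = [] \<or> m < hd B"
    using hat_fixpointD[OF w(1) _ w(3)] by blast
  \<comment> \<open>All letters before \<open>m\<close> are below \<open>m\<close>, so
    \<open>n\<close> must come after it and \<open>B\<close> is nonempty.\<close>
  have "n \<in> set w" using w(2) assms by auto
  then have "n \<in> set B" using AB(1,2) assms by auto
  then obtain b C where B: "B = b # C" "m < b" using AB(3) by (cases B) auto
  have "filter (\<lambda>y. m < y) w = [Suc m..<Suc n]"
  proof (rule sorted_distinct_set_unique)
    show "set (filter (\<lambda>y. m < y) w) = set [Suc m..<Suc n]"
      unfolding set_filter w(2) by auto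
  qed (use w in \<open>simp_all del: upt_Suc\<close>)
  also have "[Suc m..<Suc n] = Suc m # [m + 2..<Suc n]" using assms by (simp add: upt_rec)
  also have "filter (\<lambda>y. m < y) w = b # filter (\<lambda>y. m < y) C"
  proof -
    have "filter (\<lambda>y. m < y) A = []" using AB(2) by (auto simp: filter_empty_conv)
    then show ?thesis using AB(1) B by simp
  qed
  finally have b: "b = Suc m" and filC: "filter (\<lambda>y. m < y) C = [m + 2..<Suc n]" by auto
  have weq: "w = A @ m # Suc m # C" using AB B b by simp
  define R where "R = {x \<in> set C. x < m}"
  have mC: "m \<notin> set C" using w(1) weq by simp
  have setC_gt: "{x \<in> set C. m < x} = {m + 2..<Suc n}"
    using arg_cong[OF filC, of set] by (simp del: upt_Suc)
  have RC: "set C = R \<union> set [m + 2..<Suc n]"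
  proof -
    have "set C = R \<union> {x \<in> set C. m < x}"
      using mC unfolding R_def by (auto simp: not_less le_less)
    also have "{x \<in> set C. m < x} = set [m + 2..<Suc n]"
      unfolding setC_gt by (simp only: set_upt)
    finally show ?thesis .
  qed
  have filR: "filter (\<lambda>x. x \<notin> R) C = [m + 2..<Suc n]"
  proof -
    have "filter (\<lambda>x. x \<notin> R) C = filter (\<lambda>y. m < y) C"
      using mC by (intro filter_cong) (auto simp: R_def not_less le_less)
    then show ?thesis using filC by simp
  qed
  have "R \<inter> set [m + 2..<Suc n] = {}" by (auto simp: R_def)
  from shuffled_words_iff[OF this distinct_upt] have "C \<in> shuffled_words R [m + 2..<Suc n]"
    using w(1) weq RC filR by simp
  moreover have "R \<subseteq> {1..<m}"
  proof -
    have "set C \<subseteq> {1..n}" using w(2) weq by auto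
    then show ?thesis by (auto simp: R_def)
  qed
  moreover have "A \<in> fixpoint_free_words ({1..<m} - R)"
  proof -
    have "set A = set w - {m, Suc m} - set C" using w(1) weq by auto
    also have "\<dots> = {1..<m} - R" unfolding w(2) RC using assms by auto
    finally have setA: "set A = {1..<m} - R" .
    moreover have "hat A a \<noteq> a" if "a \<in> set A" for a
      using hat_fixpoint_split(2)[of A m B a] that AB w setA by auto
    ultimately show ?thesis
      using w(1) AB(1) by (auto simp: fixpoint_free_words_def)
  qed
  ultimately have "(R, A, C) \<in> ?S" by blast
  then show "w \<in> ?f ` ?S" by (rule image_eqI[rotated]) (simp add: weq)
next
  fix w assume "w \<in> ?f ` ?S"
  then obtain R A C where R: "R \<subseteq> {1..<m}" and A: "A \<in> fixpoint_free_words ({1..<m} - R)"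
    and C: "C \<in> shuffled_words R [m + 2..<Suc n]" and w: "w = A @ m # Suc m # C"
    by auto
  have "R \<inter> set [m + 2..<Suc n] = {}" using R by auto
  from C shuffled_words_iff[OF this distinct_upt] have dC: "distinct C"
    and setC: "set C = R \<union> set [m + 2..<Suc n]"
    and filC: "filter (\<lambda>x. x \<notin> R) C = [m + 2..<Suc n]" by blast+
  have dA: "distinct A" and setA: "set A = {1..<m} - R"
    and freeA: "\<forall>a\<in>{1..<m} - R. hat A a \<noteq> a"
    using A by (auto simp: fixpoint_free_words_def permutations_of_set_def)
  have dw: "distinct (A @ m # Suc m # C)" using dA dC setA setC R by auto
  have "\<forall>a\<in>set A. a < m" "Suc m # C = [] \<or> m < hd (Suc m # C)" using setA by auto
  note split = hat_fixpoint_split[OF dw this]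
  have "set w = {1..n}" using w setA setC R assms by auto
  then have "w \<in> permutations_of_set {1..n}" using dw w by auto
  moreover have "hat w m = m" using split(1) w by simp
  moreover have "hat w a \<noteq> a" if a: "a \<in> {1..<m}" for a
  \<comment> \<open>A letter of \<open>R\<close> comes after the larger letter \<open>Suc m\<close>,
    so it is not a left-to-right maximum and cannot be fixed. A letter outside \<open>R\<close> lies
    in \<open>A\<close>, which is free of fixed points.\<close>
  proof (cases "a \<in> R")
    case True
    show ?thesis
    proof
      assume "hat w a = a"
      then have fix_a: "hat (Suc m # C) a = a" using split(3)[of a] True setC w by simp
      have "distinct (Suc m # C)" "a \<in> set (Suc m # C)" using dw True setC by auto
      from hat_fixpointD[OF this fix_a]
      obtain D E where "Suc m # C = D @ a # E" "\<forall>d\<in>set D. d < a" .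
      then show False using a by (cases D) auto
    qed
  next
    case False
    then show ?thesis using split(2)[of a] a setA freeA w by auto
  qed
  moreover have "sorted (filter (\<lambda>y. m < y) w)"
  proof -
    have "filter (\<lambda>y. m < y) A = []" using setA by (auto simp: filter_empty_conv)
    moreover have "filter (\<lambda>y. m < y) C = filter (\<lambda>x. x \<notin> R) C"
      using setC R by (intro filter_cong) auto
    ultimately have "filter (\<lambda>y. m < y) w = Suc m # [m + 2..<Suc n]"
      using w filC by simp
    then show ?thesis by (simp del: upt_Suc)
  qed
  ultimately show "w \<in> least_fixpoint_avoiders n m"
    by (simp add: least_fixpoint_avoiders_def)
qed

lemma card_least_fixpoint_avoiders:
  assumes "1 \<le> m" "m < n"
  shows "card (least_fixpoint_avoiders n m) =
    (\<Sum>r = 0..m - 1. ((m - 1) choose r) * ((n - m + r - 1) choose r) *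
      fact r * derangement_number (m - 1 - r))"
proof -
  let ?v = "[m + 2..<Suc n]"
  let ?S = "SIGMA R:Pow {1..<m}. fixpoint_free_words ({1..<m} - R) \<times> shuffled_words R ?v"
  have inj: "inj_on (\<lambda>(R, A, C). A @ m # Suc m # C) ?S"
  proof (rule inj_onI)
    fix x y
    assume "x \<in> ?S" "y \<in> ?S"
      "(\<lambda>(R, A, C). A @ m # Suc m # C) x = (\<lambda>(R, A, C). A @ m # Suc m # C) y"
    then obtain R A C R' A' C' where xy: "x = (R, A, C)" "y = (R', A', C')"
      and R: "R \<subseteq> {1..<m}" "R' \<subseteq> {1..<m}"
      and A: "A \<in> fixpoint_free_words ({1..<m} - R)" "A' \<in> fixpoint_free_words ({1..<m} - R')"
      and C: "C \<in> shuffled_words R ?v" "C' \<in> shuffled_words R' ?v"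
      and eq: "A @ m # Suc m # C = A' @ m # Suc m # C'"
      by auto
    have set_letters: "set C = R \<union> set ?v"
      if "R \<subseteq> {1..<m}" "C \<in> shuffled_words R ?v" for R C
    proof -
      have "R \<inter> set ?v = {}" using that(1) by auto
      from shuffled_words_iff[OF this distinct_upt] that(2) show ?thesis by blast
    qed
    \<comment> \<open>Since \<open>m\<close> occurs only once, its position determines
      \<open>A\<close> and \<open>C\<close>; then \<open>R\<close> is read off as the set of letters
      of \<open>C\<close> below \<open>m\<close>.\<close>
    have "m \<notin> set A" "m \<notin> set C"
      using A(1) set_letters[OF R(1) C(1)] R(1)
      by (auto simp: fixpoint_free_words_def permutations_of_set_def)
    then have eq': "A = A'" "C = C'"
      using eq append_Cons_eq_iff[of m A "Suc m # C" A' "Suc m # C'"] by simp_all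
    have "R = set C \<inter> {1..<m}" "R' = set C' \<inter> {1..<m}"
      using set_letters[OF R(1) C(1)] set_letters[OF R(2) C(2)] R by auto
    then show "x = y" using eq' xy by simp
  qed
  have fin: "finite (shuffled_words R ?v)" for R
    by (simp add: shuffled_words_def)
  have "card (least_fixpoint_avoiders n m) = card ?S"
    unfolding least_fixpoint_avoiders_eq[OF assms] by (rule card_image[OF inj])
  also have "\<dots> = (\<Sum>R\<in>Pow {1..<m}.
      card (fixpoint_free_words ({1..<m} - R)) * card (shuffled_words R ?v))"
    using fin by (subst card_SigmaI) (auto simp: card_cartesian_product)
  \<comment> \<open>The summand is kept as an abstraction applied to \<open>card R\<close>, ready
    for grouping the subsets by size with \<open>sum_Pow_card\<close>.\<close>
  also have "\<dots> = (\<Sum>R\<in>Pow {1..<m}. (\<lambda>r. derangement_number (m - 1 - r) *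
      (((n - m + r - 1) choose r) * fact r)) (card R))"
  proof (rule sum.cong[OF refl])
    fix R assume "R \<in> Pow {1..<m}"
    then have R: "R \<subseteq> {1..<m}" "finite R" by (auto intro: finite_subset)
    have "card ({1..<m} - R) = m - 1 - card R"
      using R by (simp add: card_Diff_subset)
    moreover have "R \<inter> set ?v = {}" using R by auto
    \<comment> \<open>The increasing word has \<open>n - m - 1\<close> letters; \<open>m < n\<close>
      keeps the subtractions from truncating.\<close>
    moreover have "card R + length ?v = n - m + card R - 1"
      using assms unfolding length_upt by linarith
    ultimately show "card (fixpoint_free_words ({1..<m} - R)) * card (shuffled_words R ?v) =
        (\<lambda>r. derangement_number (m - 1 - r) * (((n - m + r - 1) choose r) * fact r)) (card R)"
      using R by (simp only: card_fixpoint_free_words card_shuffled_words finite_Diff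
          finite_atLeastLessThan)
  qed
  also have "\<dots> = (\<Sum>r = 0..m - 1. ((m - 1) choose r) *
      (derangement_number (m - 1 - r) * (((n - m + r - 1) choose r) * fact r)))"
    by (subst sum_Pow_card) simp_all
  finally show ?thesis by (simp add: ac_simps)
qed

theorem theorem6p4:
  fixes n :: nat
  assumes "n \<ge> 1"
  shows "card (avoiders n ([3, 2], {(1, 1)})) =
    derangement_number n + derangement_number (n - 1) +
    (\<Sum>m = 1..n - 1. \<Sum>r = 0..m - 1.
       ((m - 1) choose r) * ((n - m + r - 1) choose r) * fact r * derangement_number (m - 1 - r))"
proof -
  let ?T = "\<lambda>m. \<Sum>r = 0..m - 1. ((m - 1) choose r) * ((n - m + r - 1) choose r) *
      fact r * derangement_number (m - 1 - r)"
  have "card (avoiders n ([3, 2], {(1, 1)})) =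
      card (fixpoint_free_words {1..n}) + card (\<Union>m\<in>{1..n}. least_fixpoint_avoiders n m)"
    unfolding avoiders_eq_Un
    by (rule card_Un_disjoint) (auto simp: fixpoint_free_words_def least_fixpoint_avoiders_def)
  also have "card (\<Union>m\<in>{1..n}. least_fixpoint_avoiders n m) =
      (\<Sum>m = 1..n. card (least_fixpoint_avoiders n m))"
  proof (rule card_UN_disjoint)
    \<comment> \<open>A word counted for \<open>j\<close> has \<open>j\<close> as a fixed point,
      whereas one counted for \<open>i\<close> has none below \<open>i\<close>. Applied in both
      directions, this makes the classes disjoint.\<close>
    have least: "i \<le> j"
      if "1 \<le> j" "w \<in> least_fixpoint_avoiders n i" "w \<in> least_fixpoint_avoiders n j" for i j w
    proof (rule ccontr)
      assume "\<not> i \<le> j"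
      then have "j \<in> {1..<i}" using that(1) by simp
      with that(2,3) show False by (simp add: least_fixpoint_avoiders_def)
    qed
    show "\<forall>i\<in>{1..n}. \<forall>j\<in>{1..n}. i \<noteq> j \<longrightarrow>
        least_fixpoint_avoiders n i \<inter> least_fixpoint_avoiders n j = {}"
    proof (intro ballI impI)
      fix i j assume ij: "i \<in> {1..n}" "j \<in> {1..n}" "i \<noteq> j"
      show "least_fixpoint_avoiders n i \<inter> least_fixpoint_avoiders n j = {}"
        using least[of i _ j] least[of j _ i] ij by (simp add: disjoint_iff) (meson le_antisym)
    qed
  qed auto
  \<comment> \<open>The term for \<open>m = n\<close> is split off: there the fixed point ends the
    word and no letter \<open>Suc m\<close> follows.\<close>
  also have "\<dots> = card (least_fixpoint_avoiders n n) +
      (\<Sum>m = 1..n - 1. card (least_fixpoint_avoiders n m))"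
  proof -
    have "{1..n} = insert n {1..n - 1}" using assms by auto
    then show ?thesis using assms by simp
  qed
  also have "(\<Sum>m = 1..n - 1. card (least_fixpoint_avoiders n m)) = (\<Sum>m = 1..n - 1. ?T m)"
    by (rule sum.cong[OF refl], rule card_least_fixpoint_avoiders) auto
  also have "card (least_fixpoint_avoiders n n) = derangement_number (n - 1)"
    by (rule card_greatest_fixpoint_avoiders[OF assms])
  finally show ?thesis by (simp add: card_fixpoint_free_words)
qed

end
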